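(* For every reduced permutation $\sigma$ of length $s$ and every $c\in\mathbb{Z}_{\ge0}^s$, $$\delta\big(\sigma[\mathbf 1+c]\big)=\delta(\sigma)+\sum_{i=1}^{s}(d_i-2)\,c_i+\sum_{(i,j)\in\mathrm{Inv}(\sigma)}c_ic_j .$$ In particular, if $x$ is an entry of a permutation $\pi$ and $D(x)$ is the number of entries of $\pi$ that form an inversion with $x$, then $\delta(\pi\setminus x)=\delta(\pi)+2-D(x)$.
   Context: For a permutation $\tau$ (one-line notation) of length $|\tau|$, $\mathrm{Inv}(\tau)=\{(i,j):i<j,\ \tau_i>\tau_j\}$, $\operatorname{inv}(\tau)=|\mathrm{Inv}(\tau)|$, and the defect is $\delta(\tau)=\operatorname{inv}(\tau)-2|\tau|+7$. $\sigma$ is reduced if $\sigma_{i+1}\ne\sigma_i+1$ for all $1\le i<|\sigma|$. $d_i$ is the number of positions $j$ with $(i,j)\in\mathrm{Inv}(\sigma)$ or $(j,i)\in\mathrm{Inv}(\sigma)$. For $b\in\mathbb{Z}_{\ge1}^s$, $\sigma[b]$ is the inflation of $\sigma$ in which the $i$th entry is replaced by an increasing run of $b_i$ entries occupying consecutive positions and consecutive values, the blocks being in the relative order of $\sigma$; $\mathbf 1=(1,\dots,1)$. $\pi\setminus x$ is obtained by deleting the entry $x$ and standardizing. *)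

theory Defs
  imports "HOL-Combinatorics.Multiset_Permutations"
begin

text \<open>
  A permutation of length \<open>n\<close> in one-line notation is an element of
  \<^term>\<open>permutations_of_set {1..n::nat}\<close>, so its entries are \<open>1, \<dots>, n\<close>; positions are list
  indices and therefore start at \<open>0\<close>.
\<close>

definition inversions :: "nat list \<Rightarrow> (nat \<times> nat) set" where
  "inversions \<tau> = {(i, j). i < j \<and> j < length \<tau> \<and> \<tau> ! i > \<tau> ! j}"

definition inv_number :: "nat list \<Rightarrow> nat" where
  "inv_number \<tau> = card (inversions \<tau>)"

definition defect :: "nat list \<Rightarrow> int" where
  "defect \<tau> = int (inv_number \<tau>) - 2 * int (length \<tau>) + 7"

definition reduced :: "nat list \<Rightarrow> bool" where
  "reduced \<sigma> \<longleftrightarrow> (\<forall>i. Suc i < length \<sigma> \<longrightarrow> \<sigma> ! Suc i \<noteq> \<sigma> ! i + 1)"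

definition inv_degree :: "nat list \<Rightarrow> nat \<Rightarrow> nat" where
  "inv_degree \<sigma> i = card {j. (i, j) \<in> inversions \<sigma> \<or> (j, i) \<in> inversions \<sigma>}"

text \<open>
  The block replacing the entry at position \<open>i\<close> consists of the \<open>b ! i\<close> consecutive values that
  come right after all values used by the blocks of the entries smaller than \<open>\<sigma> ! i\<close>.
\<close>

definition inflation_block :: "nat list \<Rightarrow> nat list \<Rightarrow> nat \<Rightarrow> nat list" where
  "inflation_block \<sigma> b i =
     (let m = (\<Sum>k\<in>{k. k < length \<sigma> \<and> \<sigma> ! k < \<sigma> ! i}. b ! k) in [m + 1..<m + b ! i + 1])"

definition inflate :: "nat list \<Rightarrow> nat list \<Rightarrow> nat list" where
  "inflate \<sigma> b = concat (map (inflation_block \<sigma> b) [0..<length \<sigma>])"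

text \<open>For distinct entries, standardizing replaces each entry by its rank, starting at \<open>1\<close>.\<close>

definition standardize :: "nat list \<Rightarrow> nat list" where
  "standardize xs = map (\<lambda>x. card {y \<in> set xs. y \<le> x}) xs"

definition delete_entry :: "nat \<Rightarrow> nat list \<Rightarrow> nat list" where
  "delete_entry x \<pi> = standardize (removeAll x \<pi>)"

definition entry_inv_degree :: "nat list \<Rightarrow> nat \<Rightarrow> nat" where
  "entry_inv_degree \<pi> x =
     card {y \<in> set \<pi>. \<exists>(i, j)\<in>inversions \<pi>. {\<pi> ! i, \<pi> ! j} = {x, y}}"

end

theory Submission
  imports Defs
begin

text \<open>
  The inversions of a concatenation are the inversions inside each factor together with the
  pairs that descend from one factor to a later one (\<open>inv_number_append\<close>,
  \<open>inv_number_concat\<close>). Both formulas follow from this count.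

  In an inflation every block is increasing, and two blocks at positions \<open>i < j\<close> contribute all
  \<open>b\<^sub>i b\<^sub>j\<close> pairs if \<open>(i, j)\<close> is an inversion of \<open>\<sigma>\<close> and none otherwise. Hence
  \<open>inv (\<sigma>[b]) = \<Sum> b\<^sub>i b\<^sub>j\<close>, the sum ranging over the inversions of \<open>\<sigma>\<close>
  (\<open>inv_number_inflate\<close>). With \<open>b = 1 + c\<close> the summand expands to
  \<open>1 + (c\<^sub>i + c\<^sub>j) + c\<^sub>i c\<^sub>j\<close>; the linear part adds up to \<open>\<Sum> d\<^sub>i c\<^sub>i\<close> because each \<open>c\<^sub>i\<close> is counted
  once for every inversion containing \<open>i\<close> (\<open>sum_inversions_endpoints\<close>). The term \<open>- 2 c\<^sub>i\<close> in the
  formula comes from the length \<open>\<Sum> (1 + c\<^sub>i)\<close>.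

  Deleting \<open>x\<close> from \<open>\<pi> = ys x zs\<close> loses the inversions that contain \<open>x\<close>, which correspond to the
  entries of \<open>ys\<close> above \<open>x\<close> and the entries of \<open>zs\<close> below \<open>x\<close>; standardizing keeps the inversions.
  So \<open>inv\<close> drops by \<open>D(x)\<close> and the length by one.
\<close>

section \<open>Inversions of concatenations\<close>

lemma finite_inversions [simp]: "finite (inversions xs)"
proof (rule finite_subset)
  show "inversions xs \<subseteq> {..<length xs} \<times> {..<length xs}"
    by (auto simp: inversions_def)
qed simp

text \<open>
  The number of pairs consisting of an entry of \<open>xs\<close> and a strictly smaller entry of \<open>ys\<close>, counted
  with multiplicity.
\<close>

definition cross_inv :: "nat list \<Rightarrow> nat list \<Rightarrow> nat" where
  "cross_inv xs ys = (\<Sum>x\<leftarrow>xs. length (filter (\<lambda>y. y < x) ys))"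

lemma cross_inv_Nil [simp]: "cross_inv [] ys = 0"
  by (simp add: cross_inv_def)

lemma cross_inv_Cons:
  "cross_inv (x # xs) ys = length (filter (\<lambda>y. y < x) ys) + cross_inv xs ys"
  by (simp add: cross_inv_def)

lemma cross_inv_append_left: "cross_inv (xs @ ys) zs = cross_inv xs zs + cross_inv ys zs"
  by (simp add: cross_inv_def)

lemma cross_inv_Cons_right:
  "cross_inv xs (z # zs) = length (filter (\<lambda>y. z < y) xs) + cross_inv xs zs"
  by (induction xs) (auto simp: cross_inv_Cons)

lemma inv_number_Nil [simp]: "inv_number [] = 0"
  by (simp add: inv_number_def inversions_def)

lemma inv_number_Cons:
  "inv_number (x # xs) = length (filter (\<lambda>y. y < x) xs) + inv_number xs"
proof -
  let ?A = "(\<lambda>j. (0 :: nat, Suc j)) ` {j. j < length xs \<and> xs ! j < x}"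
  let ?B = "map_prod Suc Suc ` inversions xs"
  have "inversions (x # xs) = ?A \<union> ?B"
  proof (intro set_eqI iffI)
    fix p
    assume "p \<in> inversions (x # xs)"
    then obtain i j where p: "p = (i, Suc j)" "i < Suc j" "j < length xs" "xs ! j < (x # xs) ! i"
      by (cases p; cases "snd p") (auto simp: inversions_def)
    then show "p \<in> ?A \<union> ?B"
      by (cases i) (auto simp: inversions_def map_prod_def image_iff)
  qed (auto simp: inversions_def)
  moreover have "card (?A \<union> ?B) = card ?A + card ?B"
    by (rule card_Un_disjoint) auto
  ultimately have "inv_number (x # xs) = card ?A + card ?B"
    by (simp only: inv_number_def)
  also have "card ?A = length (filter (\<lambda>y. y < x) xs)"
    by (subst card_image) (auto simp: inj_on_def length_filter_conv_card)
  also have "card ?B = inv_number xs"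
    by (subst card_image) (auto simp: inj_on_def inv_number_def)
  finally show ?thesis .
qed

lemma inv_number_append:
  "inv_number (xs @ ys) = inv_number xs + inv_number ys + cross_inv xs ys"
  by (induction xs) (auto simp: inv_number_Cons cross_inv_Cons)

lemma cross_inv_concat_left:
  "cross_inv (concat (map B [0..<n])) ys = (\<Sum>i<n. cross_inv (B i) ys)"
  by (induction n) (auto simp: cross_inv_append_left)

lemma inv_number_concat:
  "inv_number (concat (map B [0..<n])) =
     (\<Sum>i<n. inv_number (B i)) + (\<Sum>j<n. \<Sum>i<j. cross_inv (B i) (B j))"
  by (induction n) (auto simp: inv_number_append cross_inv_concat_left)

lemma inv_number_sorted: "sorted xs \<Longrightarrow> inv_number xs = 0"
  by (induction xs) (auto simp: inv_number_Cons filter_empty_conv not_less)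

section \<open>Inflations\<close>

lemma length_inflation_block [simp]: "length (inflation_block \<sigma> b i) = b ! i"
  by (simp add: inflation_block_def Let_def)

lemma length_inflate: "length (inflate \<sigma> b) = (\<Sum>i<length \<sigma>. b ! i)"
  by (simp add: inflate_def length_concat o_def interv_sum_list_conv_sum_set_nat atLeast0LessThan)

lemma inflation_block_less:
  assumes "j < length \<sigma>" "\<sigma> ! j < \<sigma> ! i"
    and "x \<in> set (inflation_block \<sigma> b i)" "y \<in> set (inflation_block \<sigma> b j)"
  shows "y < x"
proof -
  let ?S = "\<lambda>i. {k. k < length \<sigma> \<and> \<sigma> ! k < \<sigma> ! i}"
  \<comment> \<open>The last value of block \<open>j\<close> is at most the offset that precedes block \<open>i\<close>.\<close>
  have "(\<Sum>k\<in>?S j. b ! k) + b ! j = (\<Sum>k\<in>insert j (?S j). b ! k)"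
    by simp
  also have "\<dots> \<le> (\<Sum>k\<in>?S i. b ! k)"
    using assms(1,2) by (intro sum_mono2) auto
  finally show ?thesis
    using assms(3,4) by (auto simp: inflation_block_def Let_def)
qed

lemma cross_inv_inflation_blocks:
  assumes "distinct \<sigma>" "i < length \<sigma>" "j < length \<sigma>" "i \<noteq> j"
  shows "cross_inv (inflation_block \<sigma> b i) (inflation_block \<sigma> b j) =
           (if \<sigma> ! j < \<sigma> ! i then b ! i * b ! j else 0)"
proof (cases "\<sigma> ! j < \<sigma> ! i")
  case True
  have "length (filter (\<lambda>y. y < x) (inflation_block \<sigma> b j)) = b ! j"
    if "x \<in> set (inflation_block \<sigma> b i)" for x
    using inflation_block_less[OF assms(3) True that] by (subst filter_True) auto
  then have "cross_inv (inflation_block \<sigma> b i) (inflation_block \<sigma> b j) =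
      (\<Sum>x\<leftarrow>inflation_block \<sigma> b i. b ! j)"
    unfolding cross_inv_def by (intro arg_cong[of _ _ sum_list] map_cong) auto
  with True show ?thesis
    by (simp add: sum_list_triv)
next
  case False
  with assms have "\<sigma> ! i < \<sigma> ! j"
    by (metis linorder_neqE_nat nth_eq_iff_index_eq)
  then have "length (filter (\<lambda>y. y < x) (inflation_block \<sigma> b j)) = 0"
    if "x \<in> set (inflation_block \<sigma> b i)" for x
    using inflation_block_less[OF assms(2) _ _ that] by (force simp: filter_empty_conv)
  then have "cross_inv (inflation_block \<sigma> b i) (inflation_block \<sigma> b j) =
      (\<Sum>x\<leftarrow>inflation_block \<sigma> b i. 0)"
    unfolding cross_inv_def by (intro arg_cong[of _ _ sum_list] map_cong) auto
  with False show ?thesis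
    by simp
qed

lemma inv_number_inflate:
  assumes "distinct \<sigma>"
  shows "inv_number (inflate \<sigma> b) = (\<Sum>(i, j)\<in>inversions \<sigma>. b ! i * b ! j)"
proof -
  let ?B = "inflation_block \<sigma> b" and ?n = "length \<sigma>"
  have "inv_number (?B i) = 0" for i
    by (rule inv_number_sorted) (simp add: inflation_block_def Let_def del: upt_Suc)
  then have "inv_number (inflate \<sigma> b) = (\<Sum>j<?n. \<Sum>i<j. cross_inv (?B i) (?B j))"
    by (simp add: inflate_def inv_number_concat)
  also have "\<dots> = (\<Sum>j<?n. \<Sum>i<j. if \<sigma> ! j < \<sigma> ! i then b ! i * b ! j else 0)"
    by (intro sum.cong refl cross_inv_inflation_blocks assms) auto
  also have "\<dots> = (\<Sum>j<?n. \<Sum>i\<in>{i. i < j \<and> \<sigma> ! j < \<sigma> ! i}. b ! i * b ! j)"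
    by (intro sum.cong refl sum.mono_neutral_cong_right) auto
  also have "\<dots> = (\<Sum>(j, i)\<in>(SIGMA j:{..<?n}. {i. i < j \<and> \<sigma> ! j < \<sigma> ! i}). b ! i * b ! j)"
    by (subst sum.Sigma) auto
  also have "\<dots> = (\<Sum>(i, j)\<in>inversions \<sigma>. b ! i * b ! j)"
    by (rule sum.reindex_bij_witness[of _ prod.swap prod.swap]) (auto simp: inversions_def)
  finally show ?thesis .
qed

text \<open>Double counting: position \<open>i\<close> is an endpoint of \<open>inv_degree \<sigma> i\<close> inversions.\<close>

lemma sum_inversions_endpoints:
  fixes f :: "nat \<Rightarrow> int"
  shows "(\<Sum>(i, j)\<in>inversions \<sigma>. f i + f j) = (\<Sum>i<length \<sigma>. int (inv_degree \<sigma> i) * f i)"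
proof -
  let ?n = "length \<sigma>" and ?I = "inversions \<sigma>"
  define R where "R i = {j. (i, j) \<in> ?I}" for i
  define L where "L i = {j. (j, i) \<in> ?I}" for i
  have fin: "finite (R i)" "finite (L i)" for i
    by (rule finite_subset[of _ "{..<?n}"]; auto simp: R_def L_def inversions_def)+
  have deg: "inv_degree \<sigma> i = card (R i) + card (L i)" for i
  proof -
    have "{j. (i, j) \<in> ?I \<or> (j, i) \<in> ?I} = R i \<union> L i" "R i \<inter> L i = {}"
      by (auto simp: R_def L_def inversions_def)
    then show ?thesis
      by (simp add: inv_degree_def card_Un_disjoint fin)
  qed
  have "(\<Sum>(i, j)\<in>?I. f i) = (\<Sum>(i, j)\<in>Sigma {..<?n} R. f i)"
    by (rule sum.cong) (auto simp: R_def inversions_def)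
  also have "\<dots> = (\<Sum>i<?n. int (card (R i)) * f i)"
    by (subst sum.Sigma[symmetric]) (auto simp: fin)
  finally have 1: "(\<Sum>(i, j)\<in>?I. f i) = (\<Sum>i<?n. int (card (R i)) * f i)" .
  have "(\<Sum>(i, j)\<in>?I. f j) = (\<Sum>(j, i)\<in>Sigma {..<?n} L. f j)"
    by (rule sum.reindex_bij_witness[of _ prod.swap prod.swap]) (auto simp: L_def inversions_def)
  also have "\<dots> = (\<Sum>i<?n. int (card (L i)) * f i)"
    by (subst sum.Sigma[symmetric]) (auto simp: fin)
  finally have 2: "(\<Sum>(i, j)\<in>?I. f j) = (\<Sum>i<?n. int (card (L i)) * f i)" .
  have "(\<Sum>(i, j)\<in>?I. f i + f j) = (\<Sum>(i, j)\<in>?I. f i) + (\<Sum>(i, j)\<in>?I. f j)"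
    by (simp add: case_prod_unfold sum.distrib)
  then show ?thesis
    by (simp add: 1 2 deg algebra_simps sum.distrib)
qed

lemma defect_inflate:
  assumes "distinct \<sigma>" "length c = length \<sigma>"
  shows "defect (inflate \<sigma> (map (\<lambda>k. 1 + k) c)) =
           defect \<sigma>
           + (\<Sum>i<length \<sigma>. (int (inv_degree \<sigma> i) - 2) * int (c ! i))
           + (\<Sum>(i, j)\<in>inversions \<sigma>. int (c ! i) * int (c ! j))"
proof -
  let ?b = "map (\<lambda>k. 1 + k) c" and ?n = "length \<sigma>" and ?I = "inversions \<sigma>"
  have "int (inv_number (inflate \<sigma> ?b)) = (\<Sum>(i, j)\<in>?I. int (?b ! i) * int (?b ! j))"
    by (simp add: inv_number_inflate[OF assms(1)] case_prod_unfold)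
  also have "\<dots> = (\<Sum>(i, j)\<in>?I. 1 + (int (c ! i) + int (c ! j)) + int (c ! i) * int (c ! j))"
    by (rule sum.cong) (auto simp: inversions_def assms(2) algebra_simps)
  also have "\<dots> = int (inv_number \<sigma>) + (\<Sum>(i, j)\<in>?I. int (c ! i) + int (c ! j))
      + (\<Sum>(i, j)\<in>?I. int (c ! i) * int (c ! j))"
    by (simp add: case_prod_unfold sum.distrib inv_number_def)
  finally have inv: "int (inv_number (inflate \<sigma> ?b)) =
      int (inv_number \<sigma>) + (\<Sum>i<?n. int (inv_degree \<sigma> i) * int (c ! i))
      + (\<Sum>(i, j)\<in>?I. int (c ! i) * int (c ! j))"
    by (simp only: sum_inversions_endpoints)
  have "length (inflate \<sigma> ?b) = (\<Sum>i<?n. 1 + c ! i)"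
    unfolding length_inflate by (rule sum.cong) (auto simp: assms(2))
  then have len: "int (length (inflate \<sigma> ?b)) = int ?n + (\<Sum>i<?n. int (c ! i))"
    by (simp add: sum.distrib)
  show ?thesis
    unfolding defect_def inv len
    by (simp add: algebra_simps sum_subtractf sum_distrib_left)
qed

section \<open>Deletions\<close>

lemma length_standardize [simp]: "length (standardize xs) = length xs"
  by (simp add: standardize_def)

lemma standardize_less_iff:
  assumes "i < length xs" "j < length xs"
  shows "standardize xs ! i < standardize xs ! j \<longleftrightarrow> xs ! i < xs ! j"
proof -
  define rank where "rank x = card {y \<in> set xs. y \<le> x}" for x
  have "rank x < rank y" if "x < y" "y \<in> set xs" for x y
  proof -
    have "y \<in> {z \<in> set xs. z \<le> y} - {z \<in> set xs. z \<le> x}"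
      using that by simp
    then have "{z \<in> set xs. z \<le> x} \<subset> {z \<in> set xs. z \<le> y}"
      using that(1) by (intro psubsetI) (force, blast)
    then show ?thesis
      unfolding rank_def by (intro psubset_card_mono) auto
  qed
  moreover have "rank x \<le> rank y" if "x \<le> y" for x y
    unfolding rank_def using that by (intro card_mono) auto
  ultimately have "rank (xs ! i) < rank (xs ! j) \<longleftrightarrow> xs ! i < xs ! j"
    using assms by (meson leD not_le_imp_less nth_mem)
  then show ?thesis
    using assms by (simp add: standardize_def rank_def)
qed

lemma inv_number_standardize [simp]: "inv_number (standardize xs) = inv_number xs"
proof -
  have "inversions (standardize xs) = inversions xs"
    unfolding inversions_def by (auto simp: standardize_less_iff)
  then show ?thesis
    by (simp add: inv_number_def)
qed

lemma entry_inv_degree_split: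
  assumes "distinct (ys @ x # zs)"
  shows "entry_inv_degree (ys @ x # zs) x =
           length (filter (\<lambda>y. x < y) ys) + length (filter (\<lambda>z. z < x) zs)"
proof -
  let ?\<pi> = "ys @ x # zs"
  let ?A = "set (filter (\<lambda>y. x < y) ys)" and ?B = "set (filter (\<lambda>z. z < x) zs)"
  have "{y \<in> set ?\<pi>. \<exists>(i, j)\<in>inversions ?\<pi>. {?\<pi> ! i, ?\<pi> ! j} = {x, y}} = ?A \<union> ?B"
  proof (intro set_eqI iffI)
    fix y
    assume "y \<in> {y \<in> set ?\<pi>. \<exists>(i, j)\<in>inversions ?\<pi>. {?\<pi> ! i, ?\<pi> ! j} = {x, y}}"
    then obtain i j where ij: "i < j" "j < length ?\<pi>" "?\<pi> ! j < ?\<pi> ! i"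
        "{?\<pi> ! i, ?\<pi> ! j} = {x, y}"
      by (auto simp: inversions_def)
    have pos: "k = length ys" if "k < length ?\<pi>" "?\<pi> ! k = x" for k
      using nth_eq_iff_index_eq[OF assms that(1), of "length ys"] that(2) by simp
    consider "?\<pi> ! i = x" "?\<pi> ! j = y" | "?\<pi> ! i = y" "?\<pi> ! j = x"
      using ij(4) by (auto simp: doubleton_eq_iff)
    then show "y \<in> ?A \<union> ?B"
    proof cases
      case 1
      then have "i = length ys"
        using ij pos by simp
      then have "y \<in> set zs"
        using ij 1 by (auto simp: nth_append nth_Cons' split: if_splits)
      with 1 ij show ?thesis by simp
    next
      case 2
      then have "j = length ys"
        using ij pos by simp
      then have "y \<in> set ys"
        using ij 2 by (auto simp: nth_append)
      with 2 ij show ?thesis by simp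
    qed
  next
    fix y
    assume "y \<in> ?A \<union> ?B"
    then consider "y \<in> set ys" "x < y" | "y \<in> set zs" "y < x"
      by auto
    then show "y \<in> {y \<in> set ?\<pi>. \<exists>(i, j)\<in>inversions ?\<pi>. {?\<pi> ! i, ?\<pi> ! j} = {x, y}}"
    proof cases
      case 1
      then obtain i where "i < length ys" "ys ! i = y"
        by (auto simp: in_set_conv_nth)
      with 1 have "(i, length ys) \<in> inversions ?\<pi>"
        "{?\<pi> ! i, ?\<pi> ! length ys} = {x, y}"
        by (auto simp: inversions_def nth_append)
      with 1 show ?thesis
        by (intro CollectI conjI bexI[of _ "(i, length ys)"]) simp_all
    next
      case 2
      then obtain j where "j < length zs" "zs ! j = y"
        by (auto simp: in_set_conv_nth)
      with 2 have "(length ys, length ys + Suc j) \<in> inversions ?\<pi>"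
        "{?\<pi> ! length ys, ?\<pi> ! (length ys + Suc j)} = {x, y}"
        by (auto simp: inversions_def nth_append)
      with 2 show ?thesis
        by (intro CollectI conjI bexI[of _ "(length ys, length ys + Suc j)"]) simp_all
    qed
  qed
  then have "entry_inv_degree ?\<pi> x = card (?A \<union> ?B)"
    by (simp add: entry_inv_degree_def)
  also have "\<dots> = card ?A + card ?B"
    using assms by (intro card_Un_disjoint) auto
  also have "\<dots> = length (filter (\<lambda>y. x < y) ys) + length (filter (\<lambda>z. z < x) zs)"
    using assms by (simp only: distinct_card distinct_filter distinct_append distinct.simps)
  finally show ?thesis .
qed

lemma defect_delete_entry:
  assumes "distinct \<pi>" "x \<in> set \<pi>"
  shows "defect (delete_entry x \<pi>) = defect \<pi> + 2 - int (entry_inv_degree \<pi> x)"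
proof -
  obtain ys zs where \<pi>: "\<pi> = ys @ x # zs"
    using assms(2) by (auto simp: in_set_conv_decomp)
  have "removeAll x \<pi> = ys @ zs"
    using assms(1) by (simp add: \<pi>)
  moreover have "inv_number \<pi> = inv_number (ys @ zs) + entry_inv_degree \<pi> x"
    using assms(1) unfolding \<pi>
    by (simp add: entry_inv_degree_split inv_number_append inv_number_Cons cross_inv_Cons_right
          del: distinct_append)
  ultimately show ?thesis
    by (simp add: defect_def delete_entry_def \<pi>)
qed

section \<open>The two defect formulas\<close>

theorem proposition5p4:
  shows "(\<forall>(s::nat) \<sigma> c. \<sigma> \<in> permutations_of_set {1..s} \<longrightarrow> reduced \<sigma> \<longrightarrow> length c = s \<longrightarrow>
           defect (inflate \<sigma> (map (\<lambda>k. 1 + k) c)) =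
             defect \<sigma>
             + (\<Sum>i<s. (int (inv_degree \<sigma> i) - 2) * int (c ! i))
             + (\<Sum>(i, j)\<in>inversions \<sigma>. int (c ! i) * int (c ! j))) \<and>
         (\<forall>(n::nat) \<pi> x. \<pi> \<in> permutations_of_set {1..n} \<longrightarrow> x \<in> set \<pi> \<longrightarrow>
           defect (delete_entry x \<pi>) = defect \<pi> + 2 - int (entry_inv_degree \<pi> x))"
proof (intro conjI allI impI)
  fix s :: nat and \<sigma> c :: "nat list"
  assume \<sigma>: "\<sigma> \<in> permutations_of_set {1..s}" and c: "length c = s"
  have "length \<sigma> = s"
    using length_finite_permutations_of_set[OF \<sigma>] by simp
  with defect_inflate[of \<sigma> c] \<sigma> c
  show "defect (inflate \<sigma> (map (\<lambda>k. 1 + k) c)) =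
          defect \<sigma>
          + (\<Sum>i<s. (int (inv_degree \<sigma> i) - 2) * int (c ! i))
          + (\<Sum>(i, j)\<in>inversions \<sigma>. int (c ! i) * int (c ! j))"
    by (simp add: permutations_of_setD)
next
  fix n :: nat and \<pi> :: "nat list" and x :: nat
  assume "\<pi> \<in> permutations_of_set {1..n}" "x \<in> set \<pi>"
  then show "defect (delete_entry x \<pi>) = defect \<pi> + 2 - int (entry_inv_degree \<pi> x)"
    by (intro defect_delete_entry) (auto dest: permutations_of_setD)
qed

end
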